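(* Each Blaschke product with weak Property $\mathfrak{H}$ is a Carleson-Newman Blaschke product.
   Context: $\mathbb{D}$ is the open unit disk. An inner function is a bounded analytic function on $\mathbb{D}$ with unimodular radial limits almost everywhere on $\partial\mathbb{D}$. A Blaschke product is an inner function $B(z)=\lambda z^m\prod_n\frac{|\alpha_n|}{\alpha_n}\frac{\alpha_n-z}{1-\overline{\alpha_n}z}$ with $|\lambda|=1$, $m\ge0$ an integer, $\{\alpha_n\}$ a finite or infinite sequence in $\mathbb{D}\setminus\{0\}$ with $\sum_n(1-|\alpha_n|)<\infty$. A Blaschke product with (finite or infinite) zero sequence $\{z_n\}$ is interpolating if for every bounded sequence of complex numbers $\{w_n\}$ there is $f\in H^\infty$ (bounded analytic on $\mathbb{D}$) with $f(z_n)=w_n$ for all $n$; by Carleson's theorem this is equivalent to $\inf_n\prod_{k\ne n}\left|\frac{z_k-z_n}{1-\overline{z_k}z_n}\right|>0$. A Blaschke product is Carleson-Newman if it is a product of finitely many interpolating Blaschke products. For an inner function $u$ and $\theta\in(0,1)$ put $\Omega_{u,\theta}=\{z\in\mathbb{D}:|u(z)|<\theta\}$. Let $\rho(z_1,z_2)=\left|\frac{z_1-z_2}{1-\overline{z_1}z_2}\right|$ and $\delta_{u,\eta}=\sup\{\rho(z_1,z_2): z_1,z_2 \text{ belong to the same connected component of }\Omega_{u,\eta}\}$. Weak Property $\mathfrak{B}$: there is $\theta\in(0,1)$ such that the closure of each component of $\Omega_{u,\theta}$ is contained in $\mathbb{D}$. Weak Property $\mathfrak{H}$: $u$ has weak Property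 $\mathfrak{B}$ and there exists $\eta\in(0,1)$ with $\delta_{u,\eta}<1$. *)

theory Defs
  imports "HOL-Complex_Analysis.Complex_Analysis" "HOL-Library.Extended_Nat"
begin

text \<open>
  Functions on the unit disk are total functions on the complex numbers of which only the
  values on \<open>ball 0 1\<close> matter. A finite or infinite sequence is a pair of a length
  \<open>N :: enat\<close> and a function on \<open>nat\<close> of which only the values at indices below
  \<open>N\<close> matter; \<open>N = 0\<close> is allowed, so that unimodular constants are Blaschke products.
\<close>

definition blaschke_factor :: "complex \<Rightarrow> complex \<Rightarrow> complex" where
  "blaschke_factor a z = (of_real (cmod a) / a) * ((a - z) / (1 - cnj a * z))"

text \<open>
  The summability condition makes the infinite product converge at every point of the disk;
  only finitely many of its factors can vanish there, a case which \<^const>\<open>prodinf\<close>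
  covers, with value 0.
\<close>

definition blaschke_rep ::
    "(complex \<Rightarrow> complex) \<Rightarrow> complex \<Rightarrow> nat \<Rightarrow> enat \<Rightarrow> (nat \<Rightarrow> complex) \<Rightarrow> bool" where
  "blaschke_rep B c m N \<alpha> \<longleftrightarrow>
     cmod c = 1 \<and>
     (\<forall>n. enat n < N \<longrightarrow> \<alpha> n \<in> ball 0 1 - {0}) \<and>
     summable (\<lambda>n. if enat n < N then 1 - cmod (\<alpha> n) else 0) \<and>
     (\<forall>z\<in>ball 0 1. B z = c * z ^ m * (\<Prod>n. if enat n < N then blaschke_factor (\<alpha> n) z else 1))"

definition blaschke_product :: "(complex \<Rightarrow> complex) \<Rightarrow> bool" where
  "blaschke_product B \<longleftrightarrow> (\<exists>c m N \<alpha>. blaschke_rep B c m N \<alpha>)"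

definition H_infinity :: "(complex \<Rightarrow> complex) set" where
  "H_infinity = {f. f holomorphic_on ball 0 1 \<and> bounded (f ` ball 0 1)}"

text \<open>
  The full zero sequence, with multiplicities, of the Blaschke product with data \<open>m\<close>,
  \<open>N\<close>, \<open>\<alpha>\<close>: first \<open>m\<close> zeros at the origin, then the \<open>\<alpha> n\<close>. Its length
  is \<open>enat m + N\<close>.
\<close>

definition blaschke_zeros :: "nat \<Rightarrow> (nat \<Rightarrow> complex) \<Rightarrow> nat \<Rightarrow> complex" where
  "blaschke_zeros m \<alpha> n = (if n < m then 0 else \<alpha> (n - m))"

definition interpolating_sequence :: "enat \<Rightarrow> (nat \<Rightarrow> complex) \<Rightarrow> bool" where
  "interpolating_sequence M \<zeta> \<longleftrightarrow>
     (\<forall>w :: nat \<Rightarrow> complex. bounded (range w) \<longrightarrow>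
        (\<exists>f\<in>H_infinity. \<forall>n. enat n < M \<longrightarrow> f (\<zeta> n) = w n))"

text \<open>
  A Blaschke product determines its zero sequence up to order, and being interpolating does
  not depend on the order, so the choice of representation is immaterial.
\<close>

definition interpolating_blaschke :: "(complex \<Rightarrow> complex) \<Rightarrow> bool" where
  "interpolating_blaschke B \<longleftrightarrow>
     (\<exists>c m N \<alpha>. blaschke_rep B c m N \<alpha> \<and>
        interpolating_sequence (enat m + N) (blaschke_zeros m \<alpha>))"

definition carleson_newman :: "(complex \<Rightarrow> complex) \<Rightarrow> bool" where
  "carleson_newman B \<longleftrightarrow> blaschke_product B \<and>
     (\<exists>k (b :: nat \<Rightarrow> complex \<Rightarrow> complex). (\<forall>i<k. interpolating_blaschke (b i)) \<and>
        (\<forall>z\<in>ball 0 1. B z = (\<Prod>i<k. b i z)))"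

definition sublevel :: "(complex \<Rightarrow> complex) \<Rightarrow> real \<Rightarrow> complex set" where
  "sublevel u \<theta> = {z \<in> ball 0 1. cmod (u z) < \<theta>}"

definition pseudohyperbolic :: "complex \<Rightarrow> complex \<Rightarrow> real" where
  "pseudohyperbolic z1 z2 = cmod ((z1 - z2) / (1 - cnj z1 * z2))"

text \<open>
  The inserted 0 only matters when the sublevel set is empty (the supremum of the empty set
  is then 0); otherwise it is the distance of a point to itself.
\<close>

definition component_diameter :: "(complex \<Rightarrow> complex) \<Rightarrow> real \<Rightarrow> real" where
  "component_diameter u \<eta> =
     Sup (insert 0 {pseudohyperbolic z1 z2 | z1 z2.
       \<exists>C\<in>components (sublevel u \<eta>). z1 \<in> C \<and> z2 \<in> C})"

definition weak_property_B :: "(complex \<Rightarrow> complex) \<Rightarrow> bool" where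
  "weak_property_B u \<longleftrightarrow>
     (\<exists>\<theta>. 0 < \<theta> \<and> \<theta> < 1 \<and> (\<forall>C\<in>components (sublevel u \<theta>). closure C \<subseteq> ball 0 1))"

definition weak_property_H :: "(complex \<Rightarrow> complex) \<Rightarrow> bool" where
  "weak_property_H u \<longleftrightarrow>
     weak_property_B u \<and> (\<exists>\<eta>. 0 < \<eta> \<and> \<eta> < 1 \<and> component_diameter u \<eta> < 1)"

end

theory Submission
  imports Defs
begin

text \<open>
  If \<open>component_diameter B \<eta> < \<gamma> < 1\<close>, then every point of the disk is within
  pseudohyperbolic distance \<open>\<gamma>\<close> of a point \<open>w\<close> with \<open>cmod (B w) \<ge> \<eta>\<close>. Taking logarithms
  in the product for \<open>B w\<close> bounds \<open>\<Sum>n. 1 - \<rho>(\<alpha> n, w)\<^sup>2\<close>, and moving from \<open>w\<close> to a nearby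
  \<open>z\<close> costs only a constant factor, so \<open>\<Sum>n. 1 - \<rho>(\<alpha> n, z)\<^sup>2\<close> is bounded uniformly in \<open>z\<close>. In
  particular each zero has boundedly many neighbours at distance less than \<open>1/2\<close>, and a greedy
  colouring splits the zeros into finitely many separated classes. On each class the
  Carleson-type bound makes P. Jones' explicit interpolating functions work; they are only used
  for finite subsets, and Montel's theorem gives interpolation on the whole class.
\<close>

section \<open>Pseudohyperbolic geometry\<close>

lemma one_minus_cnj_mult_nonzero:
  assumes "cmod a < 1" "cmod z < 1"
  shows "1 - cnj a * z \<noteq> 0"
proof
  assume "1 - cnj a * z = 0"
  then have "cmod a * cmod z = 1"
    by (metis complex_mod_cnj norm_mult norm_one right_minus_eq)
  moreover have "cmod a * cmod z < 1 * 1"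
    using assms by (intro mult_strict_mono') auto
  ultimately show False by simp
qed

lemma cmod_one_minus_cnj_mult_commute: "cmod (1 - cnj a * z) = cmod (1 - cnj z * a)"
  by (metis complex_cnj_cnj complex_cnj_diff complex_cnj_mult complex_cnj_one complex_mod_cnj mult.commute)

lemma pseudohyperbolic_commute: "pseudohyperbolic a z = pseudohyperbolic z a"
  by (simp add: pseudohyperbolic_def norm_divide cmod_one_minus_cnj_mult_commute[of a] norm_minus_commute)

lemma pseudohyperbolic_nonneg: "0 \<le> pseudohyperbolic a z"
  by (simp add: pseudohyperbolic_def)

lemma pseudohyperbolic_eq_0_iff:
  assumes "cmod a < 1" "cmod z < 1"
  shows "pseudohyperbolic a z = 0 \<longleftrightarrow> a = z"
  using one_minus_cnj_mult_nonzero[OF assms] by (simp add: pseudohyperbolic_def)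

lemma pseudohyperbolic_eq_Moebius: "pseudohyperbolic a z = cmod (Moebius_function 0 a z)"
  by (simp add: pseudohyperbolic_def Moebius_function_simple norm_divide norm_minus_commute)

text \<open>Expansion in real and imaginary parts. Divided by its left-hand side, the identity
  becomes the closed form of 1 - \<rho>^2 on which all later estimates rest.\<close>

lemma cmod_one_minus_cnj_mult_square:
  "(cmod (1 - cnj a * z))\<^sup>2 = (cmod (a - z))\<^sup>2 + (1 - (cmod a)\<^sup>2) * (1 - (cmod z)\<^sup>2)"
  unfolding cmod_power2 by (simp add: power2_eq_square algebra_simps)

lemma one_minus_pseudohyperbolic_square:
  assumes "cmod a < 1" "cmod z < 1"
  shows "1 - (pseudohyperbolic a z)\<^sup>2 =
    (1 - (cmod a)\<^sup>2) * (1 - (cmod z)\<^sup>2) / (cmod (1 - cnj a * z))\<^sup>2"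
proof -
  have "(cmod (1 - cnj a * z))\<^sup>2 \<noteq> 0"
    using one_minus_cnj_mult_nonzero[OF assms] by simp
  then show ?thesis
    using cmod_one_minus_cnj_mult_square[of a z]
    by (simp add: pseudohyperbolic_def norm_divide power_divide field_simps)
qed

lemma one_minus_cmod_square_pos: "cmod a < 1 \<Longrightarrow> 0 < 1 - (cmod a)\<^sup>2"
  by (simp add: power_less_one_iff abs_square_less_1)

lemma pseudohyperbolic_less_1:
  assumes "cmod a < 1" "cmod z < 1"
  shows "pseudohyperbolic a z < 1"
  using Moebius_function_norm_lt_1[OF assms] by (simp add: pseudohyperbolic_eq_Moebius)

lemma pseudohyperbolic_square_le_1:
  assumes "cmod a < 1" "cmod z < 1"
  shows "(pseudohyperbolic a z)\<^sup>2 \<le> 1"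
  using pseudohyperbolic_less_1[OF assms] pseudohyperbolic_nonneg[of a z]
  by (simp add: power_le_one)

lemma cmod_one_minus_cnj_mult_ge:
  assumes "cmod a \<le> 1" "cmod z \<le> 1"
  shows "1 - (cmod z)\<^sup>2 \<le> 2 * cmod (1 - cnj a * z)"
proof -
  have "cmod (cnj a * z) \<le> 1 * cmod z"
    using assms by (simp add: norm_mult mult_left_le_one_le)
  then have "1 - cmod z \<le> cmod (1 - cnj a * z)"
    using norm_triangle_ineq2[of 1 "cnj a * z"] by simp
  moreover have "1 - (cmod z)\<^sup>2 = (1 - cmod z) * (1 + cmod z)"
    by (simp add: power2_eq_square algebra_simps)
  moreover have "(1 - cmod z) * (1 + cmod z) \<le> (1 - cmod z) * 2"
    using assms by (intro mult_left_mono) auto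
  ultimately show ?thesis by simp
qed

section \<open>Comparison of 1 - \<rho>^2 at nearby points\<close>

text \<open>Write \<open>1 - cnj z * w\<close> as 1 - |z|^2 plus \<open>cnj z * (z - w)\<close>. By
  closeness the second term is at most \<gamma> times the modulus being estimated, so it is absorbed
  on the left.\<close>

lemma cmod_one_minus_cnj_mult_le_of_close:
  assumes z: "cmod z < 1" and w: "cmod w < 1" and \<gamma>: "pseudohyperbolic z w \<le> \<gamma>"
  shows "(1 - \<gamma>) * cmod (1 - cnj z * w) \<le> 1 - (cmod z)\<^sup>2"
proof -
  have "0 < cmod (1 - cnj z * w)"
    using one_minus_cnj_mult_nonzero[OF z w] by simp
  then have 1: "cmod (z - w) \<le> \<gamma> * cmod (1 - cnj z * w)"
    using \<gamma> by (simp add: pseudohyperbolic_def norm_divide field_simps)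
  have 2: "complex_of_real (1 - (cmod z)\<^sup>2) = 1 - cnj z * z"
    by (simp add: complex_norm_square del: of_real_power)
  have "1 - cnj z * w = of_real (1 - (cmod z)\<^sup>2) + cnj z * (z - w)"
    unfolding 2 by (simp add: algebra_simps)
  then have "cmod (1 - cnj z * w) \<le> cmod (of_real (1 - (cmod z)\<^sup>2)) + cmod (cnj z * (z - w))"
    by (metis norm_triangle_ineq)
  also have "cmod (of_real (1 - (cmod z)\<^sup>2)) = 1 - (cmod z)\<^sup>2"
    using one_minus_cmod_square_pos[OF z] by (simp only: norm_of_real)
  also have "cmod (cnj z * (z - w)) \<le> cmod (z - w)"
    using z by (simp add: norm_mult mult_left_le_one_le)
  finally show ?thesis using 1 by (simp add: algebra_simps)
qed

text \<open>By the closed form of 1 - \<rho>^2 only 1 - |z|^2 and |1 - cnj a * z| have to be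
  compared with their counterparts at \<open>w\<close>. With t = 1 - \<gamma> the first comparison
  costs 2 / t and the second, after squaring, 4 / t^2.\<close>

lemma one_minus_pseudohyperbolic_square_transfer:
  assumes z: "cmod z < 1" and w: "cmod w < 1" and a: "cmod a < 1"
    and \<gamma>: "pseudohyperbolic z w \<le> \<gamma>" "\<gamma> < 1"
  shows "1 - (pseudohyperbolic a z)\<^sup>2 \<le> 8 / (1 - \<gamma>)^3 * (1 - (pseudohyperbolic a w)\<^sup>2)"
proof -
  define x where "x = cmod (1 - cnj a * z)"
  define y where "y = cmod (1 - cnj a * w)"
  define d where "d = cmod (1 - cnj z * w)"
  define t where "t = 1 - \<gamma>"
  have t: "0 < t" "t \<le> 1"
    using \<gamma> pseudohyperbolic_nonneg[of z w] by (auto simp: t_def)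
  have xpos: "0 < x" and ypos: "0 < y" and dpos: "0 < d"
    using one_minus_cnj_mult_nonzero a z w by (auto simp: x_def y_def d_def)
  have d1: "t * d \<le> 1 - (cmod z)\<^sup>2"
    using cmod_one_minus_cnj_mult_le_of_close[OF z w \<gamma>(1)] by (simp add: d_def t_def)
  have d2: "t * d \<le> 1 - (cmod w)\<^sup>2"
    using cmod_one_minus_cnj_mult_le_of_close[OF w z] \<gamma>(1)
    by (simp add: d_def t_def pseudohyperbolic_commute[of w] cmod_one_minus_cnj_mult_commute[of w])
  have zd: "1 - (cmod z)\<^sup>2 \<le> 2 * d"
    using cmod_one_minus_cnj_mult_ge[of w z] z w
    by (simp add: d_def cmod_one_minus_cnj_mult_commute[of w])
  have zx: "1 - (cmod z)\<^sup>2 \<le> 2 * x"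
    using cmod_one_minus_cnj_mult_ge[of a z] z a by (simp add: x_def)
  have "cmod (z - w) \<le> \<gamma> * d"
    using \<gamma> dpos by (simp add: pseudohyperbolic_def norm_divide field_simps d_def)
  moreover have "1 - cnj a * w = (1 - cnj a * z) + cnj a * (z - w)"
    by (simp add: algebra_simps)
  then have "y \<le> x + cmod (cnj a * (z - w))"
    unfolding y_def x_def by (metis norm_triangle_ineq)
  moreover have "cmod (cnj a * (z - w)) \<le> cmod (z - w)"
    using a by (simp add: norm_mult mult_left_le_one_le)
  ultimately have "y \<le> x + \<gamma> * d" by linarith
  \<comment> \<open>The factor \<open>t\<close> brings \<open>d1\<close> into play:
    \<open>t * d\<close> is at most 1 - |z|^2, hence at most \<open>2 * x\<close>, so the distance
    term is controlled by \<open>x\<close>.\<close>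
  then have "t * y \<le> t * x + \<gamma> * (t * d)"
    using t mult_left_mono[of y "x + \<gamma> * d" t] by (simp add: algebra_simps)
  also have "\<dots> \<le> t * x + \<gamma> * (2 * x)"
    using d1 zx \<gamma>(1) pseudohyperbolic_nonneg[of z w] by (intro add_left_mono mult_left_mono) linarith+
  also have "\<dots> = (1 + \<gamma>) * x"
    by (simp add: t_def algebra_simps)
  also have "\<dots> \<le> 2 * x"
    using xpos \<gamma> by simp
  finally have yx: "t * y \<le> 2 * x" .
  have zw: "t * (1 - (cmod z)\<^sup>2) \<le> 2 * (1 - (cmod w)\<^sup>2)"
  proof -
    have "t * (1 - (cmod z)\<^sup>2) \<le> t * (2 * d)"
      using zd t by (intro mult_left_mono) auto
    also have "\<dots> = 2 * (t * d)" by simp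
    also have "\<dots> \<le> 2 * (1 - (cmod w)\<^sup>2)" using d2 by simp
    finally show ?thesis .
  qed
  define A where "A = 1 - (cmod a)\<^sup>2"
  define Z where "Z = 1 - (cmod z)\<^sup>2"
  define W where "W = 1 - (cmod w)\<^sup>2"
  have pos: "0 < A" "0 < Z" "0 < W"
    using one_minus_cmod_square_pos a z w by (auto simp: A_def Z_def W_def)
  have "(t * y)\<^sup>2 \<le> (2 * x)\<^sup>2"
    using yx t ypos by (intro power_mono) auto
  then have "(t * Z) * (t * y)\<^sup>2 \<le> (2 * W) * (2 * x)\<^sup>2"
    by (rule mult_mono[OF zw[folded Z_def W_def]]) (use pos in auto)
  then have "A * ((t * Z) * (t * y)\<^sup>2) \<le> A * ((2 * W) * (2 * x)\<^sup>2)"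
    using pos by (intro mult_left_mono) auto
  then have "A * Z / x\<^sup>2 \<le> 8 / t^3 * (A * W / y\<^sup>2)"
    using xpos ypos t by (simp add: field_simps power2_eq_square power3_eq_cube)
  then show ?thesis
    by (simp add: one_minus_pseudohyperbolic_square a z w A_def Z_def W_def x_def y_def t_def)
qed

section \<open>Pseudohyperbolic discs and components of sublevel sets\<close>

text \<open>\<open>Moebius_function 0 z\<close> sends \<open>z\<close> to the origin and has inverse
  \<open>Moebius_function 0 (-z)\<close>, so the set is a continuous image of a Euclidean
  disc.\<close>

lemma connected_pseudohyperbolic_cball:
  assumes z: "cmod z < 1" and \<gamma>: "\<gamma> < 1"
  shows "connected {w \<in> ball 0 1. pseudohyperbolic z w \<le> \<gamma>}"
proof -
  have "{w \<in> ball 0 1. pseudohyperbolic z w \<le> \<gamma>} = Moebius_function 0 (-z) ` cball 0 \<gamma>"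
  proof (intro set_eqI iffI)
    fix w assume "w \<in> {w \<in> ball 0 1. pseudohyperbolic z w \<le> \<gamma>}"
    then have "Moebius_function 0 z w \<in> cball 0 \<gamma>" "cmod w < 1"
      by (auto simp: pseudohyperbolic_eq_Moebius)
    moreover have "w = Moebius_function 0 (-z) (Moebius_function 0 z w)"
      using Moebius_function_compose[of "-z" z w] z \<open>cmod w < 1\<close> by simp
    ultimately show "w \<in> Moebius_function 0 (-z) ` cball 0 \<gamma>" by blast
  next
    fix w assume "w \<in> Moebius_function 0 (-z) ` cball 0 \<gamma>"
    then obtain u where u: "cmod u \<le> \<gamma>" "w = Moebius_function 0 (-z) u" by auto
    then have "Moebius_function 0 z w = u" "cmod w < 1"
      using Moebius_function_compose[of z "-z" u] Moebius_function_norm_lt_1[of "-z" u] z \<gamma> by auto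
    then show "w \<in> {w \<in> ball 0 1. pseudohyperbolic z w \<le> \<gamma>}"
      using u by (simp add: pseudohyperbolic_eq_Moebius)
  qed
  moreover have "continuous_on (cball 0 \<gamma>) (Moebius_function 0 (-z))"
    using z \<gamma> Moebius_function_holomorphic[of "-z" 0]
    by (auto intro!: continuous_on_subset[OF holomorphic_on_imp_continuous_on])
  ultimately show ?thesis
    by (metis connected_continuous_image convex_cball convex_connected)
qed

lemma exists_pseudohyperbolic_eq:
  assumes "cmod z < 1" "0 \<le> \<gamma>" "\<gamma> < 1"
  obtains w where "cmod w < 1" "pseudohyperbolic z w = \<gamma>"
proof
  show "cmod (Moebius_function 0 (-z) (of_real \<gamma>)) < 1"
    using assms by (intro Moebius_function_norm_lt_1) auto
  show "pseudohyperbolic z (Moebius_function 0 (-z) (of_real \<gamma>)) = \<gamma>"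
    using assms Moebius_function_compose[of z "-z" "of_real \<gamma>"] by (simp add: pseudohyperbolic_eq_Moebius)
qed

text \<open>A connected set through \<open>z\<close> of pseudohyperbolic radius larger than the component
  diameter cannot stay inside the sublevel set.\<close>

lemma exists_large_value_nearby:
  assumes \<gamma>: "component_diameter u \<eta> < \<gamma>" "\<gamma> < 1" and z: "cmod z < 1"
  obtains w where "cmod w < 1" "pseudohyperbolic z w \<le> \<gamma>" "\<eta> \<le> cmod (u w)"
proof (rule ccontr)
  assume contra: "\<not> thesis"
  define K where "K = {w \<in> ball 0 1. pseudohyperbolic z w \<le> \<gamma>}"
  define X where "X = insert 0 {pseudohyperbolic z1 z2 | z1 z2.
       \<exists>C\<in>components (sublevel u \<eta>). z1 \<in> C \<and> z2 \<in> C}"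
  \<comment> \<open>The real \<open>Sup\<close> is an upper bound only for a set that is bounded
    above, so the bound 1 is needed before the diameter can be used.\<close>
  have le1: "x \<le> 1" if x: "x \<in> X" for x
  proof (cases "x = 0")
    case False
    then obtain z1 z2 C where "x = pseudohyperbolic z1 z2" "C \<in> components (sublevel u \<eta>)" "z1 \<in> C" "z2 \<in> C"
      using x by (auto simp: X_def)
    moreover from this have "cmod z1 < 1" "cmod z2 < 1"
      using in_components_subset[of C "sublevel u \<eta>"] by (auto simp: sublevel_def)
    ultimately show ?thesis using pseudohyperbolic_less_1 by (simp add: less_imp_le)
  qed simp
  then have bdd: "bdd_above X" by (meson bdd_above.I)
  have "0 \<le> component_diameter u \<eta>"
    unfolding component_diameter_def X_def[symmetric] by (rule cSup_upper[OF _ bdd]) (simp add: X_def)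
  then have \<gamma>0: "0 \<le> \<gamma>" using \<gamma> by simp
  \<comment> \<open>Without a value of modulus at least \<eta> on \<open>K\<close>, this connected
    disc lies in the sublevel set and hence in a single component.\<close>
  have "K \<subseteq> sublevel u \<eta>"
    using contra that by (force simp: K_def sublevel_def)
  moreover have "connected K" unfolding K_def using connected_pseudohyperbolic_cball z \<gamma> by blast
  moreover have zK: "z \<in> K"
    using z \<gamma>0 by (simp add: K_def pseudohyperbolic_eq_0_iff pseudohyperbolic_def)
  ultimately obtain C where C: "C \<in> components (sublevel u \<eta>)" "K \<subseteq> C"
    by (metis exists_component_superset empty_iff empty_subsetI subset_empty)
  \<comment> \<open>A point at distance exactly \<gamma> from \<open>z\<close> makes \<gamma> itself
    a member of \<open>X\<close>, against the choice of \<gamma> above the supremum.\<close>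
  obtain w where w: "cmod w < 1" "pseudohyperbolic z w = \<gamma>"
    using exists_pseudohyperbolic_eq[OF z \<gamma>0 \<gamma>(2)] .
  then have "w \<in> C" using C by (auto simp: K_def)
  then have "\<gamma> \<in> X" using C zK w by (auto simp: X_def)
  then have "\<gamma> \<le> component_diameter u \<eta>"
    unfolding component_diameter_def X_def[symmetric] by (rule cSup_upper[OF _ bdd])
  then show False using \<gamma> by simp
qed

section \<open>Interpolation on separated sets\<close>

text \<open>Put y = x^2, so that y is at least 1/4. Then 1/y - 1 = (1 - y) / y is at most 4 * (1 -
  y), which gives exp (-4 * (1 - y)) \<le> y \<le> x for each factor. The constant 4 is the inverse
  square of the separation 1/2.\<close>

lemma prod_ge_exp_of_sum_one_minus_square_le:
  fixes x :: "'i \<Rightarrow> real"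
  assumes "finite F" and x: "\<And>i. i \<in> F \<Longrightarrow> 1/2 \<le> x i" "\<And>i. i \<in> F \<Longrightarrow> x i \<le> 1"
    and M: "(\<Sum>i\<in>F. 1 - (x i)\<^sup>2) \<le> M"
  shows "exp (- 4 * M) \<le> (\<Prod>i\<in>F. x i)"
proof -
  have le: "exp (- 4 * (1 - (x i)\<^sup>2)) \<le> x i" if "i \<in> F" for i
  proof -
    define y where "y = (x i)\<^sup>2"
    have xi: "1/2 \<le> x i" "x i \<le> 1" using x that by auto
    have "(1/2)\<^sup>2 \<le> (x i)\<^sup>2" using xi by (intro power_mono) auto
    then have y: "1/4 \<le> y" "y \<le> x i" "y \<le> 1"
      using xi by (auto simp: y_def power2_eq_square mult_left_le mult_le_one)
    have "1/y - 1 = (1 - y) * (1/y)" using y by (simp add: field_simps)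
    also have "\<dots> \<le> (1 - y) * 4" using y by (intro mult_left_mono) (auto simp: field_simps)
    finally have "1 / y \<le> 1 + 4 * (1 - y)" by simp
    also have "\<dots> \<le> exp (4 * (1 - y))" by (rule exp_ge_add_one_self)
    finally have "1 \<le> y * exp (4 * (1 - y))" using y by (simp add: field_simps)
    moreover have "exp (- 4 * (1 - y)) = 1 / exp (4 * (1 - y))"
      by (metis exp_minus inverse_eq_divide mult_minus_left)
    ultimately have "exp (- 4 * (1 - y)) \<le> y" by (simp add: divide_le_eq)
    then show ?thesis using y unfolding y_def by linarith
  qed
  have "exp (- 4 * M) \<le> exp (- 4 * (\<Sum>i\<in>F. 1 - (x i)\<^sup>2))" using M by simp
  also have "\<dots> = (\<Prod>i\<in>F. exp (- 4 * (1 - (x i)\<^sup>2)))"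
    using \<open>finite F\<close> by (simp add: sum_distrib_left exp_sum[symmetric])
  also have "\<dots> \<le> (\<Prod>i\<in>F. x i)" using le by (intro prod_mono) auto
  finally show ?thesis .
qed

text \<open>Each x^2 is at most exp (-(1 - x^2)), by 1 + s \<le> exp s. Multiplying and taking
  logarithms gives the bound; the factor 2 comes from squaring the product.\<close>

lemma sum_one_minus_square_le_of_prod_ge:
  fixes x :: "'i \<Rightarrow> real"
  assumes "finite F" and x: "\<And>i. i \<in> F \<Longrightarrow> 0 \<le> x i"
    and \<eta>: "0 < \<eta>" "\<eta> \<le> (\<Prod>i\<in>F. x i)"
  shows "(\<Sum>i\<in>F. 1 - (x i)\<^sup>2) \<le> - 2 * ln \<eta>"
proof -
  have "\<eta>\<^sup>2 \<le> (\<Prod>i\<in>F. x i)\<^sup>2" using \<eta> by (intro power_mono) auto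
  also have "\<dots> = (\<Prod>i\<in>F. (x i)\<^sup>2)" by (simp add: prod_power_distrib)
  also have "\<dots> \<le> (\<Prod>i\<in>F. exp (- (1 - (x i)\<^sup>2)))"
  proof (intro prod_mono conjI)
    fix i show "(x i)\<^sup>2 \<le> exp (- (1 - (x i)\<^sup>2))"
      using exp_ge_add_one_self[of "- (1 - (x i)\<^sup>2)"] by simp
  qed auto
  also have "\<dots> = exp (- (\<Sum>i\<in>F. 1 - (x i)\<^sup>2))"
    using \<open>finite F\<close> by (simp only: exp_sum[symmetric] sum_negf)
  finally have "ln (\<eta>\<^sup>2) \<le> - (\<Sum>i\<in>F. 1 - (x i)\<^sup>2)"
    using \<eta> by (metis exp_le_cancel_iff exp_ln zero_less_power)
  then show ?thesis using \<eta> by (simp add: ln_realpow)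
qed

text \<open>The sum is a lower Riemann sum of \<open>exp (-t)\<close> over the half-line.\<close>

lemma sum_mult_exp_tail_le_1:
  fixes a r :: "'i \<Rightarrow> real"
  assumes "finite J" "\<And>i. 0 \<le> a i"
  shows "(\<Sum>j\<in>J. a j * exp (- (\<Sum>k\<in>{k\<in>J. r j \<le> r k}. a k))) \<le> 1"
  using assms(1)
\<comment> \<open>The element \<open>x\<close> added last has the largest rank, so it lies in every
  tail. The old terms all gain the factor exp (- a x), the new term is at most a x * exp (- a x),
  and 1 + a x \<le> exp (a x) closes the induction.\<close>
proof (induction J rule: finite_ranking_induct[where f = r])
  case (insert x J)
  show ?case
  \<comment> \<open>This induction rule does not supply x \<notin> J.\<close>
  proof (cases "x \<in> J")
    case True then show ?thesis using insert.IH by (simp add: insert_absorb)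
  next
    case False
    let ?T = "\<lambda>J j. \<Sum>k\<in>{k\<in>J. r j \<le> r k}. a k"
    have T: "?T (insert x J) j = a x + ?T J j" if "j \<in> J" for j
    proof -
      have "{k\<in>insert x J. r j \<le> r k} = insert x {k\<in>J. r j \<le> r k}"
        using insert.hyps that by auto
      then show ?thesis using insert.hyps False by simp
    qed
    have Tx: "a x \<le> ?T (insert x J) x"
      using insert.hyps assms(2) by (intro member_le_sum) auto
    have "(\<Sum>j\<in>insert x J. a j * exp (- ?T (insert x J) j))
        = a x * exp (- ?T (insert x J) x) + (\<Sum>j\<in>J. a j * exp (- (a x + ?T J j)))"
      using insert.hyps False T by simp
    also have "(\<Sum>j\<in>J. a j * exp (- (a x + ?T J j))) = exp (- a x) * (\<Sum>j\<in>J. a j * exp (- ?T J j))"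
      by (simp add: sum_distrib_left exp_add[symmetric] exp_diff exp_minus field_simps)
    also have "\<dots> \<le> exp (- a x) * 1"
      using insert.IH by (intro mult_left_mono) auto
    also have "a x * exp (- ?T (insert x J) x) \<le> a x * exp (- a x)"
      using Tx assms(2) by (intro mult_left_mono) auto
    finally have "(\<Sum>j\<in>insert x J. a j * exp (- ?T (insert x J) j)) \<le> (1 + a x) * exp (- a x)"
      by (simp add: algebra_simps)
    also have "\<dots> \<le> exp (a x) * exp (- a x)"
      using exp_ge_add_one_self[of "a x"] by (intro mult_right_mono) auto
    finally show ?thesis by (simp add: exp_minus)
  qed
qed simp

section \<open>Poisson weights\<close>

lemma Re_Cayley:
  assumes "v \<noteq> 1"
  shows "Re ((1 + v) / (1 - v)) = (1 - (cmod v)\<^sup>2) / (cmod (1 - v))\<^sup>2"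
  unfolding Re_divide cmod_power2 by (simp add: power2_eq_square algebra_simps)

text \<open>The factor 1 - |a|^2 times the Poisson kernel (1 - |v|^2) / |1 - v|^2 at v = cnj a * z.
  With |cnj a * z| in place of |z| in the numerator, the weight is the real part of a function
  holomorphic in \<open>z\<close>, so the exponential of minus a sum of weights is the modulus of a
  holomorphic function.\<close>

definition poisson_weight :: "complex \<Rightarrow> complex \<Rightarrow> real" where
  "poisson_weight a z = (1 - (cmod a)\<^sup>2) * (1 - (cmod (cnj a * z))\<^sup>2) / (cmod (1 - cnj a * z))\<^sup>2"

lemma poisson_weight_eq_Re:
  assumes "cmod a < 1" "cmod z < 1"
  shows "poisson_weight a z = Re (of_real (1 - (cmod a)\<^sup>2) * ((1 + cnj a * z) / (1 - cnj a * z)))"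
proof -
  have "Re (of_real r * v) = r * Re v" for r v by simp
  moreover have "cnj a * z \<noteq> 1" using one_minus_cnj_mult_nonzero[OF assms] by auto
  ultimately show ?thesis by (metis poisson_weight_def Re_Cayley times_divide_eq_right)
qed

lemma cmod_cnj_mult_le:
  assumes "cmod a \<le> 1"
  shows "(cmod (cnj a * z))\<^sup>2 \<le> (cmod z)\<^sup>2"
  using assms by (intro power_mono) (auto simp: norm_mult mult_left_le_one_le)

lemma poisson_weight_nonneg:
  assumes "cmod a < 1" "cmod z < 1"
  shows "0 \<le> poisson_weight a z"
proof -
  have "(cmod (cnj a * z))\<^sup>2 \<le> (cmod z)\<^sup>2" using assms by (intro cmod_cnj_mult_le) auto
  then have "0 \<le> 1 - (cmod (cnj a * z))\<^sup>2" using one_minus_cmod_square_pos[of z] assms by linarith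
  then show ?thesis unfolding poisson_weight_def using one_minus_cmod_square_pos[of a] assms
    by (intro divide_nonneg_nonneg mult_nonneg_nonneg) auto
qed

text \<open>Since |cnj a * z| \<le> |a|, one of the two factors 1 - |a|^2 in the square may be
  enlarged to 1 - |cnj a * z|^2.\<close>

lemma square_le_poisson_weight:
  assumes "cmod a < 1" "cmod z < 1"
  shows "((1 - (cmod a)\<^sup>2) / cmod (1 - cnj a * z))\<^sup>2 \<le> poisson_weight a z"
proof -
  have "(cmod (cnj z * a))\<^sup>2 \<le> (cmod a)\<^sup>2" using assms by (intro cmod_cnj_mult_le) auto
  then have "(cmod (cnj a * z))\<^sup>2 \<le> (cmod a)\<^sup>2" by (simp add: norm_mult mult.commute)
  then have "(1 - (cmod a)\<^sup>2) * (1 - (cmod a)\<^sup>2) \<le> (1 - (cmod a)\<^sup>2) * (1 - (cmod (cnj a * z))\<^sup>2)"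
    using one_minus_cmod_square_pos[of a] assms by (intro mult_left_mono) auto
  then show ?thesis
    by (simp add: poisson_weight_def power_divide power2_eq_square[of "1 - (cmod a)\<^sup>2"] divide_right_mono)
qed

text \<open>The order of the moduli gives 1 - |a|^2 |z|^2 \<le> 1 - |z|^4 \<le> 2 * (1 - |z|^2),
  which replaces the numerator of the weight by that of 1 - \<rho>^2.\<close>

lemma poisson_weight_le:
  assumes a: "cmod a < 1" and z: "cmod z < 1" and le: "cmod z \<le> cmod a"
  shows "poisson_weight a z \<le> 2 * (1 - (pseudohyperbolic a z)\<^sup>2)"
proof -
  define x y where "x = (cmod a)\<^sup>2" and "y = (cmod z)\<^sup>2"
  have xy: "0 \<le> y" "y \<le> x" "x \<le> 1" "y \<le> 1"
    using assms unfolding x_def y_def by (auto simp: power_le_one intro: power_mono)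
  have "(2 - y) * y \<le> 1" using sum_squares_bound[of 1 y] zero_le_power2[of "1 - y"]
    by (simp add: power2_eq_square algebra_simps)
  have "y * y \<le> x * y" using xy by (intro mult_right_mono) auto
  then have "1 - x * y \<le> 2 * (1 - y)"
    using \<open>(2 - y) * y \<le> 1\<close> by (simp add: algebra_simps)
  then have "(1 - x) * (1 - x * y) \<le> (1 - x) * (2 * (1 - y))"
    using xy by (intro mult_left_mono) auto
  then have "(1 - x) * (1 - x * y) / (cmod (1 - cnj a * z))\<^sup>2 \<le> (1 - x) * (2 * (1 - y)) / (cmod (1 - cnj a * z))\<^sup>2"
    by (intro divide_right_mono) auto
  then show ?thesis
    by (simp add: poisson_weight_def one_minus_pseudohyperbolic_square[OF a z] x_def y_def
        norm_mult power_mult_distrib algebra_simps)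
qed

text \<open>In P. Jones' functions \<open>F j\<close> the factor \<open>G j\<close> produces the zeros, \<open>H j\<close> the decay away from
  \<open>\<zeta> j\<close>; the squared modulus of \<open>H j\<close> is at most a Poisson weight, and \<open>E j\<close>, the exponential of
  minus the tail of these weights, makes the sum over \<open>j\<close> bounded.\<close>

lemma finite_interpolation:
  fixes \<zeta> :: "'i \<Rightarrow> complex"
  assumes "finite J" and \<zeta>: "\<And>j. j \<in> J \<Longrightarrow> cmod (\<zeta> j) < 1"
    and sep: "\<And>j k. j \<in> J \<Longrightarrow> k \<in> J \<Longrightarrow> j \<noteq> k \<Longrightarrow> 1/2 \<le> pseudohyperbolic (\<zeta> k) (\<zeta> j)"
    and M: "\<And>j. j \<in> J \<Longrightarrow> (\<Sum>k\<in>J. 1 - (pseudohyperbolic (\<zeta> k) (\<zeta> j))\<^sup>2) \<le> M"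
    and w: "\<And>j. j \<in> J \<Longrightarrow> cmod (w j) \<le> W" and "0 \<le> W"
  obtains f where "f holomorphic_on ball 0 1" "\<And>z. z \<in> ball 0 1 \<Longrightarrow> cmod (f z) \<le> W * exp (6 * M)"
    "\<And>j. j \<in> J \<Longrightarrow> f (\<zeta> j) = w j"
proof -
  define \<phi> where "\<phi> k z = Moebius_function 0 (\<zeta> k) z" for k z
  define q where "q k z = complex_of_real (1 - (cmod (\<zeta> k))\<^sup>2) * ((1 + cnj (\<zeta> k) * z) / (1 - cnj (\<zeta> k) * z))" for k z
  \<comment> \<open>The tail is ordered by modulus so that \<open>poisson_weight_le\<close> applies
    at \<open>\<zeta> j\<close> to every k in \<open>T j\<close>.\<close>
  define T where "T j = {k\<in>J. cmod (\<zeta> j) \<le> cmod (\<zeta> k)}" for j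
  define G where "G j z = (\<Prod>k\<in>J-{j}. \<phi> k z / \<phi> k (\<zeta> j))" for j z
  define H where "H j z = complex_of_real (1 - (cmod (\<zeta> j))\<^sup>2) / (1 - cnj (\<zeta> j) * z)" for j z
  \<comment> \<open>Subtracting \<open>q k (\<zeta> j)\<close> normalises \<open>E j\<close> to 1 at
    \<open>\<zeta> j\<close>. The real part of \<open>q k\<close> is the Poisson weight, so |E j| is
    governed by a difference of two tails.\<close>
  define E where "E j z = exp (- (\<Sum>k\<in>T j. q k z - q k (\<zeta> j)))" for j z
  define F where "F j z = G j z * (H j z)\<^sup>2 * E j z" for j z
  have nz: "1 - cnj (\<zeta> k) * z \<noteq> 0" if "k \<in> J" "cmod z < 1" for k z
    using one_minus_cnj_mult_nonzero \<zeta> that by blast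
  have \<phi>nz: "\<phi> k (\<zeta> j) \<noteq> 0" if "k \<in> J - {j}" "j \<in> J" for k j
  proof
    assume "\<phi> k (\<zeta> j) = 0"
    then have "pseudohyperbolic (\<zeta> k) (\<zeta> j) = 0"
      by (simp add: \<phi>_def pseudohyperbolic_eq_Moebius)
    then show False using sep[of j k] that by auto
  qed
  have self: "F j (\<zeta> j) = 1" if j: "j \<in> J" for j
  proof -
    have "G j (\<zeta> j) = 1" unfolding G_def using \<phi>nz j by (intro prod.neutral) auto
    moreover have "complex_of_real (1 - (cmod (\<zeta> j))\<^sup>2) = 1 - cnj (\<zeta> j) * \<zeta> j"
      by (simp add: complex_norm_square del: of_real_power)
    then have "H j (\<zeta> j) = 1" unfolding H_def using nz[OF j \<zeta>[OF j]] by (metis divide_self)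
    ultimately show ?thesis by (simp add: F_def E_def)
  qed
  have other: "F j (\<zeta> k) = 0" if "j \<in> J" "k \<in> J" "k \<noteq> j" for j k
  proof -
    have "\<phi> k (\<zeta> k) = 0" by (simp add: \<phi>_def Moebius_function_eq_zero)
    then have "G j (\<zeta> k) = 0" unfolding G_def using that \<open>finite J\<close>
      by (intro prod_zero) auto
    then show ?thesis by (simp add: F_def)
  qed
  have hol: "F j holomorphic_on ball 0 1" if j: "j \<in> J" for j
    unfolding F_def G_def H_def E_def q_def \<phi>_def Moebius_function_simple
    using nz j \<phi>nz by (intro holomorphic_intros) (auto simp: T_def \<phi>_def Moebius_function_simple)
  have bnd: "cmod (F j z) \<le> exp (6 * M) * (poisson_weight (\<zeta> j) z
        * exp (- (\<Sum>k\<in>T j. poisson_weight (\<zeta> k) z)))" if j: "j \<in> J" and z: "cmod z < 1" for j z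
  proof -
    \<comment> \<open>The index j is removed because its factor \<rho>(\<zeta> j, \<zeta> j) = 0
      would spoil the lower bound on the product.\<close>
    have "(\<Sum>k\<in>J-{j}. 1 - (pseudohyperbolic (\<zeta> k) (\<zeta> j))\<^sup>2)
        \<le> (\<Sum>k\<in>J. 1 - (pseudohyperbolic (\<zeta> k) (\<zeta> j))\<^sup>2)"
      using \<open>finite J\<close> j \<zeta> by (intro sum_mono2) (auto simp: pseudohyperbolic_square_le_1)
    then have "(\<Sum>k\<in>J-{j}. 1 - (pseudohyperbolic (\<zeta> k) (\<zeta> j))\<^sup>2) \<le> M"
      using M[OF j] by linarith
    then have "exp (- 4 * M) \<le> (\<Prod>k\<in>J-{j}. pseudohyperbolic (\<zeta> k) (\<zeta> j))"
      using \<open>finite J\<close> j \<zeta> sep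
      by (intro prod_ge_exp_of_sum_one_minus_square_le) (auto simp: less_imp_le pseudohyperbolic_less_1)
    then have den: "exp (- 4 * M) \<le> (\<Prod>k\<in>J-{j}. cmod (\<phi> k (\<zeta> j)))"
      by (simp add: \<phi>_def pseudohyperbolic_eq_Moebius)
    have num: "(\<Prod>k\<in>J-{j}. cmod (\<phi> k z)) \<le> 1"
      using \<zeta> z Moebius_function_norm_lt_1 by (intro prod_le_1) (auto simp: \<phi>_def less_imp_le)
    have "cmod (G j z) = (\<Prod>k\<in>J-{j}. cmod (\<phi> k z)) / (\<Prod>k\<in>J-{j}. cmod (\<phi> k (\<zeta> j)))"
      by (simp add: G_def prod_norm[symmetric] norm_divide prod_dividef)
    also have "\<dots> \<le> 1 / exp (- 4 * M)"
      using num den by (intro frac_le) auto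
    finally have G: "cmod (G j z) \<le> exp (4 * M)" by (simp add: exp_minus inverse_eq_divide)
    have H: "cmod ((H j z)\<^sup>2) \<le> poisson_weight (\<zeta> j) z"
      using square_le_poisson_weight[OF \<zeta>[OF j] z] one_minus_cmod_square_pos[OF \<zeta>[OF j]]
      unfolding H_def norm_power norm_divide norm_of_real by simp
    have re: "Re (q k x) = poisson_weight (\<zeta> k) x" if "k \<in> J" "cmod x < 1" for k x
      using poisson_weight_eq_Re[OF \<zeta>[OF that(1)] that(2)] by (simp add: q_def)
    \<comment> \<open>The normalisation of \<open>E j\<close> costs the tail at
      \<open>\<zeta> j\<close>, which is at most 2 * M. With the 4 * M from \<open>G j\<close> this
      accounts for the exponent 6 * M.\<close>
    have "(\<Sum>k\<in>T j. poisson_weight (\<zeta> k) (\<zeta> j)) \<le> (\<Sum>k\<in>T j. 2 * (1 - (pseudohyperbolic (\<zeta> k) (\<zeta> j))\<^sup>2))"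
      using \<zeta> j by (intro sum_mono poisson_weight_le) (auto simp: T_def)
    also have "\<dots> \<le> (\<Sum>k\<in>J. 2 * (1 - (pseudohyperbolic (\<zeta> k) (\<zeta> j))\<^sup>2))"
      using \<open>finite J\<close> j \<zeta> by (intro sum_mono2) (auto simp: pseudohyperbolic_square_le_1 T_def)
    also have "\<dots> \<le> 2 * M" using M[OF j] by (simp only: sum_distrib_left[symmetric])
    finally have "(\<Sum>k\<in>T j. poisson_weight (\<zeta> k) (\<zeta> j)) \<le> 2 * M" .
    moreover have "Re (\<Sum>k\<in>T j. q k z - q k (\<zeta> j)) =
        (\<Sum>k\<in>T j. poisson_weight (\<zeta> k) z) - (\<Sum>k\<in>T j. poisson_weight (\<zeta> k) (\<zeta> j))"
      using z \<zeta>[OF j] by (simp add: re T_def sum_subtractf)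
    ultimately have "cmod (E j z) \<le> exp (2 * M - (\<Sum>k\<in>T j. poisson_weight (\<zeta> k) z))"
      by (simp add: E_def)
    then have Eb: "cmod (E j z) \<le> exp (2 * M) * exp (- (\<Sum>k\<in>T j. poisson_weight (\<zeta> k) z))"
      by (simp add: exp_add[symmetric])
    have "cmod (F j z) \<le> exp (4 * M) * poisson_weight (\<zeta> j) z *
        (exp (2 * M) * exp (- (\<Sum>k\<in>T j. poisson_weight (\<zeta> k) z)))"
      unfolding F_def norm_mult using G H Eb poisson_weight_nonneg[OF \<zeta>[OF j] z]
      by (intro mult_mono) auto
    also have "\<dots> = (exp (4 * M) * exp (2 * M)) * (poisson_weight (\<zeta> j) z * exp (- (\<Sum>k\<in>T j. poisson_weight (\<zeta> k) z)))"
      by (simp only: ac_simps)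
    also have "exp (4 * M) * exp (2 * M) = exp (6 * M)" by (simp add: exp_add[symmetric])
    finally show ?thesis .
  qed
  define f where "f z = (\<Sum>j\<in>J. w j * F j z)" for z
  show thesis
  proof (rule that)
    show "f holomorphic_on ball 0 1"
      unfolding f_def by (intro holomorphic_intros hol)
    show "f (\<zeta> j) = w j" if "j \<in> J" for j
    proof -
      have "f (\<zeta> j) = (\<Sum>i\<in>J. if i = j then w j else 0)"
        unfolding f_def using self other that by (intro sum.cong) auto
      then show ?thesis using that \<open>finite J\<close> by simp
    qed
    fix z :: complex assume "z \<in> ball 0 1"
    then have z: "cmod z < 1" by simp
    \<comment> \<open>Extension by 0 outside \<open>J\<close>, because
      \<open>sum_mult_exp_tail_le_1\<close> asks for nonnegative values at all indices.\<close>
    define a where "a k = (if k \<in> J then poisson_weight (\<zeta> k) z else 0)" for k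
    have a0: "0 \<le> a k" for k using poisson_weight_nonneg \<zeta> z by (simp add: a_def)
    have "cmod (f z) \<le> (\<Sum>j\<in>J. cmod (w j) * cmod (F j z))"
      unfolding f_def by (rule order_trans[OF norm_sum]) (simp add: norm_mult)
    also have "\<dots> \<le> (\<Sum>j\<in>J. W * (exp (6 * M) * (a j * exp (- (\<Sum>k\<in>T j. a k)))))"
    proof (intro sum_mono mult_mono)
      fix j assume j: "j \<in> J"
      have "(\<Sum>k\<in>T j. a k) = (\<Sum>k\<in>T j. poisson_weight (\<zeta> k) z)"
        by (intro sum.cong) (auto simp: a_def T_def)
      then show "cmod (F j z) \<le> exp (6 * M) * (a j * exp (- (\<Sum>k\<in>T j. a k)))"
        using bnd[OF j z] j by (simp add: a_def)
    qed (use w \<open>0 \<le> W\<close> in auto)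
    also have "\<dots> = W * exp (6 * M) * (\<Sum>j\<in>J. a j * exp (- (\<Sum>k\<in>T j. a k)))"
      by (simp add: sum_distrib_left mult.assoc)
    also have "\<dots> \<le> W * exp (6 * M) * 1"
      using \<open>0 \<le> W\<close> sum_mult_exp_tail_le_1[OF \<open>finite J\<close>, of a "\<lambda>j. cmod (\<zeta> j)"] a0
      unfolding T_def by (intro mult_left_mono) auto
    finally show "cmod (f z) \<le> W * exp (6 * M)" by simp
  qed
qed

section \<open>From finite subsets to the whole set\<close>

text \<open>The bound W * exp (6 * M) is the same for every finite subset. The interpolants for S
  \<inter> {..<n} therefore form a normal family, and a limit along a subsequence keeps both the
  bound and the prescribed values.\<close>

lemma interpolation_on_set:
  fixes \<zeta> :: "nat \<Rightarrow> complex"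
  assumes \<zeta>: "\<And>j. j \<in> S \<Longrightarrow> cmod (\<zeta> j) < 1"
    and sep: "\<And>j k. j \<in> S \<Longrightarrow> k \<in> S \<Longrightarrow> j \<noteq> k \<Longrightarrow> 1/2 \<le> pseudohyperbolic (\<zeta> k) (\<zeta> j)"
    and M: "\<And>F j. finite F \<Longrightarrow> F \<subseteq> S \<Longrightarrow> j \<in> S \<Longrightarrow>
      (\<Sum>k\<in>F. 1 - (pseudohyperbolic (\<zeta> k) (\<zeta> j))\<^sup>2) \<le> M"
    and w: "bounded (range w)"
  obtains f where "f \<in> H_infinity" "\<And>j. j \<in> S \<Longrightarrow> f (\<zeta> j) = w j"
proof -
  obtain W where W: "0 < W" "\<And>n. cmod (w n) \<le> W"
    using w unfolding bounded_pos by auto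
  define C where "C = W * exp (6 * M)"
  have "\<exists>f. f holomorphic_on ball 0 1 \<and> (\<forall>z\<in>ball 0 1. cmod (f z) \<le> C) \<and>
      (\<forall>j\<in>S \<inter> {..<n}. f (\<zeta> j) = w j)" for n
  proof (rule finite_interpolation[of "S \<inter> {..<n}" \<zeta> M w W])
    fix j assume "j \<in> S \<inter> {..<n}"
    then show "(\<Sum>k\<in>S \<inter> {..<n}. 1 - (pseudohyperbolic (\<zeta> k) (\<zeta> j))\<^sup>2) \<le> M"
      by (intro M) auto
  qed (use \<zeta> sep W in \<open>auto simp: C_def\<close>)
  then obtain f where f: "\<And>n. f n holomorphic_on ball 0 1"
      "\<And>n z. z \<in> ball 0 1 \<Longrightarrow> cmod (f n z) \<le> C"
      "\<And>n j. j \<in> S \<Longrightarrow> j < n \<Longrightarrow> f n (\<zeta> j) = w j"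
    by (metis IntI lessThan_iff)
  obtain g r where g: "g holomorphic_on ball 0 1" "strict_mono (r :: nat \<Rightarrow> nat)"
      "\<And>x. x \<in> ball 0 1 \<Longrightarrow> (\<lambda>n. f (r n) x) \<longlonglongrightarrow> g x"
    by (rule Montel[of "ball 0 1" "range f" f]) (use f in \<open>auto, blast+\<close>)
  have "cmod (g z) \<le> C" if "z \<in> ball 0 1" for z
    by (rule LIMSEQ_le_const2[OF tendsto_norm[OF g(3)[OF that]]]) (use f that in auto)
  then have "g \<in> H_infinity"
    using g(1) unfolding H_infinity_def bounded_iff by blast
  moreover have "g (\<zeta> j) = w j" if j: "j \<in> S" for j
  proof (rule LIMSEQ_unique[OF g(3)])
    show "\<zeta> j \<in> ball 0 1" using \<zeta> j by simp
    \<comment> \<open>For n > j also r n \<ge> n > j, so \<open>f (r n)\<close> already takes the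
      prescribed value at \<open>\<zeta> j\<close>.\<close>
    have "eventually (\<lambda>n. f (r n) (\<zeta> j) = w j) sequentially"
      using eventually_gt_at_top[of j]
      by eventually_elim (use f(3)[OF j] seq_suble[OF g(2)] in \<open>meson less_le_trans\<close>)
    then show "(\<lambda>n. f (r n) (\<zeta> j)) \<longlonglongrightarrow> w j" by (simp add: tendsto_eventually)
  qed
  ultimately show thesis using that by blast
qed

section \<open>Decomposition of the Blaschke product\<close>

text \<open>The guard \<open>k < n\<close> inside the image shows that each recursive call descends;
  its default 0 never occurs as a colour, because the index set contains only k < n.\<close>

function greedy_colour :: "(nat \<Rightarrow> nat \<Rightarrow> bool) \<Rightarrow> nat \<Rightarrow> nat" where
  "greedy_colour R n = (LEAST c. c \<notin> (\<lambda>k. if k < n then greedy_colour R k else 0) ` {k. k < n \<and> R k n})"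
  by auto
termination by (relation "inv_image less_than snd") auto

declare greedy_colour.simps [simp del]

text \<open>When n is coloured at most K colours are forbidden, so one of the K + 1 colours 0, ...,
  K is free and the least free colour is at most K.\<close>

lemma finite_colouring:
  fixes R :: "nat \<Rightarrow> nat \<Rightarrow> bool"
  assumes "\<And>n. n \<in> S \<Longrightarrow> card {k\<in>S. k < n \<and> R k n} \<le> K"
  obtains c where "\<And>n. n \<in> S \<Longrightarrow> c n \<le> K"
    "\<And>k n. k \<in> S \<Longrightarrow> n \<in> S \<Longrightarrow> k < n \<Longrightarrow> R k n \<Longrightarrow> c k \<noteq> c n"
proof -
  \<comment> \<open>Restricting the relation to \<open>S\<close> keeps indices outside
    \<open>S\<close> from blocking colours.\<close>
  define Q where "Q k n \<longleftrightarrow> k \<in> S \<and> R k n" for k n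
  define c where "c = greedy_colour Q"
  have eq: "c n = (LEAST x. x \<notin> c ` {k. k < n \<and> Q k n})" for n
  proof -
    have "(\<lambda>k. if k < n then greedy_colour Q k else 0) ` {k. k < n \<and> Q k n} = c ` {k. k < n \<and> Q k n}"
      unfolding c_def by (intro image_cong) auto
    then show ?thesis unfolding c_def using greedy_colour.simps[of Q n] by simp
  qed
  show thesis
  proof (rule that)
    fix n assume n: "n \<in> S"
    let ?A = "c ` {k. k < n \<and> Q k n}"
    have "card ?A \<le> card {k. k < n \<and> Q k n}" by (intro card_image_le) auto
    also have "\<dots> = card {k\<in>S. k < n \<and> R k n}" by (rule arg_cong[of _ _ card]) (auto simp: Q_def)
    finally have "card ?A \<le> K" using assms[OF n] by linarith
    then have "\<not> {..K} \<subseteq> ?A"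
      using card_mono[of ?A "{..K}"] by auto
    then obtain x where "x \<le> K" "x \<notin> ?A" by auto
    then show "c n \<le> K" unfolding eq[of n] by (meson Least_le order_trans)
  next
    fix k n assume kn: "k \<in> S" "n \<in> S" "k < n" "R k n"
    \<comment> \<open>Only finitely many colours are forbidden, so the set over which
      \<open>LEAST\<close> ranges is nonempty.\<close>
    have "infinite (UNIV - c ` {k. k < n \<and> Q k n})" by simp
    then obtain x where "x \<notin> c ` {k. k < n \<and> Q k n}"
      by (metis Diff_iff ex_in_conv finite.emptyI)
    then have "c n \<notin> c ` {k. k < n \<and> Q k n}"
      unfolding eq[of n] by (rule LeastI)
    moreover have "c k \<in> c ` {k. k < n \<and> Q k n}" using kn by (intro imageI) (auto simp: Q_def)
    ultimately show "c k \<noteq> c n" by metis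
  qed
qed

section \<open>Blaschke factors and products over subsets of the zeros\<close>

lemma norm_blaschke_factor:
  assumes "a \<noteq> 0"
  shows "cmod (blaschke_factor a z) = pseudohyperbolic a z"
  using assms by (simp add: blaschke_factor_def pseudohyperbolic_def norm_mult norm_divide)

text \<open>With r = |a| and a * cnj a = r^2, the numerator of the difference factors as -(1 - r) *
  (a + r * z). The factor 1 - r is what turns the summability condition into absolute convergence of
  the product.\<close>

lemma norm_blaschke_factor_minus_1_le:
  assumes a: "a \<noteq> 0" "cmod a < 1" and z: "cmod z < 1"
  shows "cmod (blaschke_factor a z - 1) \<le> 2 / (1 - cmod z) * (1 - cmod a)"
proof -
  have nz: "1 - cnj a * z \<noteq> 0" using one_minus_cnj_mult_nonzero a z by blast
  define r where "r = complex_of_real (cmod a)"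
  have aa: "a * cnj a = r * r" unfolding r_def by (simp add: complex_norm_square[symmetric] power2_eq_square)
  have "blaschke_factor a z - 1 = (r * (a - z) - a * (1 - cnj a * z)) / (a * (1 - cnj a * z))"
    using nz a by (simp add: blaschke_factor_def r_def divide_simps)
  also have "r * (a - z) - a * (1 - cnj a * z) = r * (a - z) - a + (a * cnj a) * z"
    by (simp add: algebra_simps)
  also have "\<dots> = - ((1 - r) * (a + r * z))"
    unfolding aa by (simp add: algebra_simps)
  finally have "cmod (blaschke_factor a z - 1) = cmod (1 - r) * cmod (a + r * z) / (cmod a * cmod (1 - cnj a * z))"
    by (simp add: norm_mult norm_divide)
  also have "\<dots> \<le> ((1 - cmod a) * (2 * cmod a)) / (cmod a * (1 - cmod z))"
  proof (intro frac_le mult_mono mult_left_mono mult_nonneg_nonneg mult_pos_pos)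
    have "1 - r = of_real (1 - cmod a)" by (simp add: r_def)
    then show "cmod (1 - r) \<le> 1 - cmod a" using a by (simp only: norm_of_real)
    have "cmod (a + r * z) \<le> cmod a + cmod a * cmod z"
      by (rule order_trans[OF norm_triangle_ineq]) (simp add: r_def norm_mult)
    moreover have "cmod a * cmod z \<le> cmod a * 1" using z by (intro mult_left_mono) auto
    ultimately show "cmod (a + r * z) \<le> 2 * cmod a" by simp
    have "cmod (cnj a * z) \<le> cmod z" using a by (simp add: norm_mult mult_left_le_one_le)
    then show "1 - cmod z \<le> cmod (1 - cnj a * z)"
      using norm_triangle_ineq2[of 1 "cnj a * z"] by simp
  qed (use a z in auto)
  also have "\<dots> = 2 / (1 - cmod z) * (1 - cmod a)" using a z by (simp add: divide_simps)
  finally show ?thesis .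
qed

lemma convergent_prod_blaschke:
  assumes \<alpha>: "\<And>n. n \<in> S \<Longrightarrow> \<alpha> n \<in> ball 0 1 - {0}"
    and sum: "summable (\<lambda>n. if n \<in> S then 1 - cmod (\<alpha> n) else 0)" and z: "cmod z < 1"
  shows "convergent_prod (\<lambda>n. if n \<in> S then blaschke_factor (\<alpha> n) z else 1)"
proof -
  have "summable (\<lambda>n. 2 / (1 - cmod z) * (if n \<in> S then 1 - cmod (\<alpha> n) else 0))"
    using sum by (rule summable_mult)
  then have "summable (\<lambda>n. norm ((if n \<in> S then blaschke_factor (\<alpha> n) z else 1) - 1))"
  proof (rule summable_comparison_test'[where N = 0])
    fix n
    show "norm (norm ((if n \<in> S then blaschke_factor (\<alpha> n) z else 1) - 1))
        \<le> 2 / (1 - cmod z) * (if n \<in> S then 1 - cmod (\<alpha> n) else 0)"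
      using norm_blaschke_factor_minus_1_le[of "\<alpha> n" z] \<alpha>[of n] z by simp
  qed
  then show ?thesis
    using abs_convergent_prod_conv_summable abs_convergent_prod_imp_convergent_prod by blast
qed

text \<open>All factors have modulus at most 1, so omitting those outside \<open>F\<close> can only
  increase the modulus of a partial product. The inequality passes to the limit.\<close>

lemma norm_blaschke_prodinf_le:
  assumes \<alpha>: "\<And>n. n \<in> S \<Longrightarrow> \<alpha> n \<in> ball 0 1 - {0}"
    and sum: "summable (\<lambda>n. if n \<in> S then 1 - cmod (\<alpha> n) else 0)" and z: "cmod z < 1"
    and F: "finite F" "F \<subseteq> S"
  shows "cmod (\<Prod>n. if n \<in> S then blaschke_factor (\<alpha> n) z else 1) \<le> (\<Prod>n\<in>F. pseudohyperbolic (\<alpha> n) z)"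
proof -
  define g where "g n = (if n \<in> S then blaschke_factor (\<alpha> n) z else 1)" for n
  have g: "norm (g n) \<le> 1" for n
    using \<alpha>[of n] pseudohyperbolic_less_1[of "\<alpha> n" z] z
    by (auto simp: g_def norm_blaschke_factor less_imp_le)
  obtain n0 where n0: "F \<subseteq> {..n0}" using F(1) by (metis finite_nat_set_iff_bounded_le atMost_iff subsetI)
  have lim: "(\<lambda>n. norm (\<Prod>i\<le>n. g i)) \<longlonglongrightarrow> norm (prodinf g)"
    by (intro tendsto_norm convergent_prod_LIMSEQ)
       (use convergent_prod_blaschke[OF \<alpha> sum z] in \<open>simp add: g_def[abs_def]\<close>)
  have "norm (prodinf g) \<le> (\<Prod>n\<in>F. norm (g n))"
  proof (rule LIMSEQ_le_const2[OF lim], intro exI allI impI)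
    fix n assume "n0 \<le> n"
    then have "F \<subseteq> {..n}" using n0 by auto
    then have "(\<Prod>i\<le>n. norm (g i)) = (\<Prod>i\<in>{..n}-F. norm (g i)) * (\<Prod>i\<in>F. norm (g i))"
      by (intro prod.subset_diff) auto
    also have "\<dots> \<le> 1 * (\<Prod>i\<in>F. norm (g i))"
      using g by (intro mult_right_mono prod_le_1 prod_nonneg) auto
    finally show "norm (\<Prod>i\<le>n. g i) \<le> (\<Prod>i\<in>F. norm (g i))" by (simp add: prod_norm)
  qed
  also have "\<dots> = (\<Prod>n\<in>F. pseudohyperbolic (\<alpha> n) z)"
    using F \<alpha> by (intro prod.cong) (auto simp: g_def norm_blaschke_factor)
  finally show ?thesis by (simp add: g_def[abs_def])
qed

text \<open>The partial product of \<open>f \<circ> e\<close> up to n is that of \<open>f\<close> up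
  to \<open>e n\<close>, since the skipped factors are 1. One sequence of partial products is thus a
  subsequence of the other.\<close>

lemma prodinf_mono_reindex:
  fixes f :: "nat \<Rightarrow> 'a :: {real_normed_field}"
  assumes e: "strict_mono e" and f: "\<And>n. n \<notin> range e \<Longrightarrow> f n = 1"
    and conv: "convergent_prod f" "convergent_prod (\<lambda>n. f (e n))"
  shows "(\<Prod>n. f (e n)) = prodinf f"
proof (rule LIMSEQ_unique)
  show "(\<lambda>n. \<Prod>i\<le>n. f (e i)) \<longlonglongrightarrow> (\<Prod>n. f (e n))"
    using conv(2) by (rule convergent_prod_LIMSEQ)
  have "(\<Prod>i\<le>n. f (e i)) = (\<Prod>i\<le>e n. f i)" for n
  proof -
    have inj: "inj e" using e by (rule strict_mono_imp_inj_on)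
    have "(\<Prod>i\<le>n. f (e i)) = (\<Prod>i\<in>e ` {..n}. f i)"
      using inj by (simp add: prod.reindex inj_on_subset)
    also have "\<dots> = (\<Prod>i\<le>e n. f i)"
    proof (rule prod.mono_neutral_left)
      show "e ` {..n} \<subseteq> {..e n}" using e by (auto simp: strict_mono_less_eq)
      show "\<forall>i\<in>{..e n} - e ` {..n}. f i = 1"
        using e by (auto intro!: f simp: strict_mono_less_eq)
    qed simp
    finally show ?thesis .
  qed
  then show "(\<lambda>n. \<Prod>i\<le>n. f (e i)) \<longlonglongrightarrow> prodinf f"
    using LIMSEQ_subseq_LIMSEQ[OF convergent_prod_LIMSEQ[OF conv(1)] e] by (simp add: o_def)
qed

text \<open>A representation needs zeros indexed by an initial segment of the naturals, so
  \<open>S\<close> is enumerated. The enumeration is increasing, which in the infinite case allows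
  \<open>prodinf_mono_reindex\<close>; in the finite case both sides are finite products.\<close>

lemma blaschke_rep_subset:
  assumes \<alpha>: "\<And>n. n \<in> S \<Longrightarrow> \<alpha> n \<in> ball 0 1 - {0}"
    and sum: "summable (\<lambda>n. if n \<in> S then 1 - cmod (\<alpha> n) else 0)"
  obtains N e where "bij_betw e {n. enat n < N} S"
    "blaschke_rep (\<lambda>z. \<Prod>n. if n \<in> S then blaschke_factor (\<alpha> n) z else 1) 1 0 N (\<lambda>n. \<alpha> (e n))"
proof (cases "finite S")
  case True
  define e where "e = enumerate S"
  have bij: "bij_betw e {..<card S} S" unfolding e_def by (rule finite_bij_enumerate[OF True])
  show thesis
  proof (rule that[of e "enat (card S)"])
    show "bij_betw e {n. enat n < enat (card S)} S" using bij by (simp add: lessThan_def)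
    have eS: "e n \<in> S" if "n < card S" for n using bij that by (auto simp: bij_betw_def)
    have "(\<Prod>n. if n \<in> S then blaschke_factor (\<alpha> n) z else 1) =
        (\<Prod>n. if n < card S then blaschke_factor (\<alpha> (e n)) z else 1)" for z
    proof -
      have "(\<Prod>n. if n \<in> S then blaschke_factor (\<alpha> n) z else 1) = (\<Prod>n\<in>S. blaschke_factor (\<alpha> n) z)"
        using prodinf_finite[OF True, of "\<lambda>n. if n \<in> S then blaschke_factor (\<alpha> n) z else 1"] by simp
      also have "\<dots> = (\<Prod>n<card S. blaschke_factor (\<alpha> (e n)) z)"
        using prod.reindex_bij_betw[OF bij, of "\<lambda>n. blaschke_factor (\<alpha> n) z"] by simp
      also have "\<dots> = (\<Prod>n. if n < card S then blaschke_factor (\<alpha> (e n)) z else 1)"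
        using prodinf_finite[of "{..<card S}" "\<lambda>n. if n < card S then blaschke_factor (\<alpha> (e n)) z else 1"] by simp
      finally show ?thesis .
    qed
    moreover have "summable (\<lambda>n. if n < card S then 1 - cmod (\<alpha> (e n)) else 0)"
      by (rule summable_finite[of "{..<card S}"]) auto
    ultimately show "blaschke_rep (\<lambda>z. \<Prod>n. if n \<in> S then blaschke_factor (\<alpha> n) z else 1) 1 0
        (enat (card S)) (\<lambda>n. \<alpha> (e n))"
      using \<alpha> eS by (simp add: blaschke_rep_def)
  qed
next
  case False
  define e where "e = enumerate S"
  have bij: "bij_betw e UNIV S" unfolding e_def by (rule bij_enumerate[OF False])
  have mono: "strict_mono e" unfolding e_def using False by (simp add: strict_mono_def enumerate_mono)
  have eS: "e n \<in> S" for n using bij by (auto simp: bij_betw_def)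
  have ran: "range e = S" using bij by (simp add: bij_betw_def)
  have sum': "summable (\<lambda>n. 1 - cmod (\<alpha> (e n)))"
    using sum summable_mono_reindex[OF mono, of "\<lambda>n. if n \<in> S then 1 - cmod (\<alpha> n) else 0"] eS ran
    by simp
  show thesis
  proof (rule that[of e \<infinity>])
    show "bij_betw e {n. enat n < \<infinity>} S" using bij by simp
    have "(\<Prod>n. if n \<in> S then blaschke_factor (\<alpha> n) z else 1) = (\<Prod>n. blaschke_factor (\<alpha> (e n)) z)"
      if z: "cmod z < 1" for z
    proof -
      have 1: "convergent_prod (\<lambda>n. blaschke_factor (\<alpha> (e n)) z)"
        using convergent_prod_blaschke[of UNIV "\<lambda>n. \<alpha> (e n)" z] \<alpha>[OF eS] sum' z by simp
      have 2: "convergent_prod (\<lambda>n. if n \<in> S then blaschke_factor (\<alpha> n) z else 1)"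
        using convergent_prod_blaschke[OF \<alpha> sum z] .
      show ?thesis
        using prodinf_mono_reindex[OF mono _ 2] 1 eS ran by simp
    qed
    then show "blaschke_rep (\<lambda>z. \<Prod>n. if n \<in> S then blaschke_factor (\<alpha> n) z else 1) 1 0 \<infinity> (\<lambda>n. \<alpha> (e n))"
      using \<alpha>[OF eS] sum' by (simp add: blaschke_rep_def)
  qed
qed

lemma interpolating_blaschke_subset:
  assumes \<alpha>: "\<And>n. n \<in> S \<Longrightarrow> \<alpha> n \<in> ball 0 1 - {0}"
    and sum: "summable (\<lambda>n. if n \<in> S then 1 - cmod (\<alpha> n) else 0)"
    and sep: "\<And>j k. j \<in> S \<Longrightarrow> k \<in> S \<Longrightarrow> j \<noteq> k \<Longrightarrow> 1/2 \<le> pseudohyperbolic (\<alpha> k) (\<alpha> j)"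
    and M: "\<And>F j. finite F \<Longrightarrow> F \<subseteq> S \<Longrightarrow> j \<in> S \<Longrightarrow>
      (\<Sum>k\<in>F. 1 - (pseudohyperbolic (\<alpha> k) (\<alpha> j))\<^sup>2) \<le> M"
  shows "interpolating_blaschke (\<lambda>z. \<Prod>n. if n \<in> S then blaschke_factor (\<alpha> n) z else 1)"
proof -
  obtain N e where e: "bij_betw e {n. enat n < N} S"
    and rep: "blaschke_rep (\<lambda>z. \<Prod>n. if n \<in> S then blaschke_factor (\<alpha> n) z else 1) 1 0 N (\<lambda>n. \<alpha> (e n))"
    using blaschke_rep_subset[where S = S and \<alpha> = \<alpha>, OF \<alpha> sum] by blast
  have "interpolating_sequence (enat 0 + N) (blaschke_zeros 0 (\<lambda>n. \<alpha> (e n)))"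
    unfolding interpolating_sequence_def
  proof (intro allI impI)
    fix w :: "nat \<Rightarrow> complex" assume w: "bounded (range w)"
    \<comment> \<open>The data \<open>w\<close> are indexed by position in the enumeration;
      \<open>v\<close> carries them back to the indices in \<open>S\<close>.\<close>
    define v where "v j = w (inv_into {n. enat n < N} e j)" for j
    have "range v \<subseteq> range w" by (auto simp: v_def)
    then have v: "bounded (range v)" using w bounded_subset by blast
    obtain f where f: "f \<in> H_infinity" "\<And>j. j \<in> S \<Longrightarrow> f (\<alpha> j) = v j"
      by (rule interpolation_on_set[where S = S and \<zeta> = \<alpha> and M = M and w = v])
         (use \<alpha> sep M v in auto)
    have "f (blaschke_zeros 0 (\<lambda>n. \<alpha> (e n)) n) = w n" if "enat n < enat 0 + N" for n
    proof -
      have n: "n \<in> {n. enat n < N}" using that by (simp add: zero_enat_def[symmetric])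
      then have "e n \<in> S" using e by (auto simp: bij_betw_def)
      moreover have "v (e n) = w n" using e n by (simp add: v_def bij_betw_def)
      ultimately show ?thesis using f by (simp add: blaschke_zeros_def)
    qed
    then show "\<exists>f\<in>H_infinity. \<forall>n. enat n < enat 0 + N \<longrightarrow> f (blaschke_zeros 0 (\<lambda>n. \<alpha> (e n)) n) = w n"
      using f by blast
  qed
  then show ?thesis using rep unfolding interpolating_blaschke_def by blast
qed

section \<open>Finite products of interpolating Blaschke products\<close>

text \<open>The zero sequence is empty (m = 0 and N = 0), so there is nothing to interpolate and the
  zero function serves.\<close>

lemma interpolating_blaschke_const:
  assumes "cmod c = 1"
  shows "interpolating_blaschke (\<lambda>z. c)"
  unfolding interpolating_blaschke_def blaschke_rep_def interpolating_sequence_def H_infinity_def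
  by (intro exI[of _ c] exI[of _ "0::nat"] exI[of _ "0::enat"] exI[of _ "\<lambda>_. 0"] conjI)
     (use assms in \<open>auto simp: zero_enat_def[symmetric] image_constant_conv intro!: exI[of _ "\<lambda>_. 0"]\<close>)

text \<open>The only zero is a simple one at the origin, where a constant function takes the
  prescribed value.\<close>

lemma interpolating_blaschke_id: "interpolating_blaschke (\<lambda>z. z)"
proof -
  have "\<exists>f\<in>H_infinity. \<forall>n. enat n < enat 1 + 0 \<longrightarrow> f (blaschke_zeros 1 (\<lambda>_. 0) n) = w n"
    for w :: "nat \<Rightarrow> complex"
    by (rule bexI[of _ "\<lambda>_. w 0"])
       (auto simp: H_infinity_def bounded_iff blaschke_zeros_def)
  then show ?thesis
    unfolding interpolating_blaschke_def blaschke_rep_def interpolating_sequence_def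
    by (intro exI[of _ "1::complex"] exI[of _ "1::nat"] exI[of _ "0::enat"] exI[of _ "\<lambda>_. 0"]) simp
qed

text \<open>The second half of \<open>carleson_newman\<close>, separated so that factors can be
  added one at a time without showing at each stage that the product is a Blaschke product.\<close>

definition finite_interpolating_product :: "(complex \<Rightarrow> complex) \<Rightarrow> bool" where
  "finite_interpolating_product f \<longleftrightarrow>
     (\<exists>k (b :: nat \<Rightarrow> complex \<Rightarrow> complex). (\<forall>i<k. interpolating_blaschke (b i)) \<and>
        (\<forall>z\<in>ball 0 1. f z = (\<Prod>i<k. b i z)))"

lemma finite_interpolating_product_mult:
  assumes "finite_interpolating_product f" "interpolating_blaschke g"
  shows "finite_interpolating_product (\<lambda>z. f z * g z)"
proof -
  obtain k :: nat and b where b: "\<forall>i<k. interpolating_blaschke (b i)" "\<forall>z\<in>ball 0 1. f z = (\<Prod>i<k. b i z)"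
    using assms(1) unfolding finite_interpolating_product_def by blast
  have "(\<forall>i<Suc k. interpolating_blaschke ((b(k := g)) i)) \<and>
      (\<forall>z\<in>ball 0 1. f z * g z = (\<Prod>i<Suc k. (b(k := g)) i z))"
    using b assms(2) by (auto simp: less_Suc_eq)
  then show ?thesis unfolding finite_interpolating_product_def by blast
qed

lemma finite_interpolating_product_prod:
  fixes f :: "nat \<Rightarrow> complex \<Rightarrow> complex"
  assumes "\<And>i. i < k \<Longrightarrow> interpolating_blaschke (f i)"
  shows "finite_interpolating_product (\<lambda>z. \<Prod>i<k. f i z)"
  unfolding finite_interpolating_product_def using assms by blast

lemma finite_interpolating_product_cong:
  assumes "\<And>z. z \<in> ball 0 1 \<Longrightarrow> f z = g z"
  shows "finite_interpolating_product f \<longleftrightarrow> finite_interpolating_product g"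
  unfolding finite_interpolating_product_def using assms by simp

text \<open>The power is split into m factors z, because for m \<ge> 2 the zero sequence of z^m
  repeats the origin, where two different values cannot be prescribed.\<close>

lemma finite_interpolating_product_mult_power:
  assumes "finite_interpolating_product f"
  shows "finite_interpolating_product (\<lambda>z. f z * z ^ m)"
proof (induction m)
  case (Suc m)
  then show ?case
    using finite_interpolating_product_mult[OF Suc interpolating_blaschke_id] by (simp add: mult_ac)
qed (use assms in simp)

section \<open>The uniform sum bound and the splitting of the zeros\<close>

text \<open>This is the conformally invariant form of the Carleson measure condition for the masses
  1 - |\<alpha> n|^2 at the points \<alpha> n. The bound holds first at a nearby point where |B| is
  at least \<eta> and is then transferred to \<open>z\<close>.\<close>

lemma carleson_condition_of_component_diameter:
  assumes rep: "blaschke_rep B c m N \<alpha>" and \<eta>: "0 < \<eta>" "component_diameter B \<eta> < 1"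
  obtains M where "\<And>z F. cmod z < 1 \<Longrightarrow> finite F \<Longrightarrow> F \<subseteq> {n. enat n < N} \<Longrightarrow>
    (\<Sum>n\<in>F. 1 - (pseudohyperbolic (\<alpha> n) z)\<^sup>2) \<le> M"
proof -
  define S where "S = {n. enat n < N}"
  have \<alpha>: "\<And>n. n \<in> S \<Longrightarrow> \<alpha> n \<in> ball 0 1 - {0}"
    and sum: "summable (\<lambda>n. if n \<in> S then 1 - cmod (\<alpha> n) else 0)"
    and B: "\<And>z. cmod z < 1 \<Longrightarrow> B z = c * z ^ m * (\<Prod>n. if n \<in> S then blaschke_factor (\<alpha> n) z else 1)"
    and c: "cmod c = 1"
    using rep by (simp_all add: blaschke_rep_def S_def)
  obtain \<gamma> where \<gamma>: "component_diameter B \<eta> < \<gamma>" "\<gamma> < 1" using dense \<eta>(2) by blast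
  \<comment> \<open>The cost of moving from \<open>w\<close> to \<open>z\<close>, times the
    logarithmic bound at \<open>w\<close>.\<close>
  define M where "M = 8 / (1 - \<gamma>)^3 * (- 2 * ln \<eta>)"
  have bound: "(\<Sum>n\<in>F. 1 - (pseudohyperbolic (\<alpha> n) z)\<^sup>2) \<le> M"
    if z: "cmod z < 1" and F: "finite F" "F \<subseteq> S" for z F
  proof -
    obtain w where w: "cmod w < 1" "pseudohyperbolic z w \<le> \<gamma>" "\<eta> \<le> cmod (B w)"
      using exists_large_value_nearby[OF \<gamma> z] .
    \<comment> \<open>Dropping |w^m| \<le> 1 and the zeros outside \<open>F\<close> only increases
      the right-hand side.\<close>
    have "\<eta> \<le> cmod (w ^ m) * cmod (\<Prod>n. if n \<in> S then blaschke_factor (\<alpha> n) w else 1)"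
      using w B c by (simp add: norm_mult)
    also have "\<dots> \<le> 1 * (\<Prod>n\<in>F. pseudohyperbolic (\<alpha> n) w)"
      using norm_blaschke_prodinf_le[OF \<alpha> sum w(1) F] w(1)
      by (intro mult_mono) (auto simp: norm_power power_le_one)
    finally have "(\<Sum>n\<in>F. 1 - (pseudohyperbolic (\<alpha> n) w)\<^sup>2) \<le> - 2 * ln \<eta>"
      using \<eta> F pseudohyperbolic_nonneg by (intro sum_one_minus_square_le_of_prod_ge) auto
    then have "8 / (1 - \<gamma>)^3 * (\<Sum>n\<in>F. 1 - (pseudohyperbolic (\<alpha> n) w)\<^sup>2) \<le> M"
      unfolding M_def using \<gamma> by (intro mult_left_mono) auto
    moreover have "(\<Sum>n\<in>F. 1 - (pseudohyperbolic (\<alpha> n) z)\<^sup>2)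
        \<le> (\<Sum>n\<in>F. 8 / (1 - \<gamma>)^3 * (1 - (pseudohyperbolic (\<alpha> n) w)\<^sup>2))"
    proof (intro sum_mono one_minus_pseudohyperbolic_square_transfer z w \<gamma>)
      show "cmod (\<alpha> n) < 1" if "n \<in> F" for n using \<alpha>[of n] that F by auto
    qed
    ultimately show ?thesis unfolding sum_distrib_left by linarith
  qed
  show thesis
    by (rule that) (use bound S_def in blast)
qed

theorem proposition4p14:
  fixes B :: "complex \<Rightarrow> complex"
  assumes "blaschke_product B"
    and "weak_property_H B"
  shows "carleson_newman B"
proof -
  obtain c m N \<alpha> where rep: "blaschke_rep B c m N \<alpha>"
    using assms(1) unfolding blaschke_product_def by blast
  define S where "S = {n. enat n < N}"
  have \<alpha>: "\<And>n. n \<in> S \<Longrightarrow> \<alpha> n \<in> ball 0 1 - {0}"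
    and sum: "summable (\<lambda>n. if n \<in> S then 1 - cmod (\<alpha> n) else 0)"
    and B: "\<And>z. cmod z < 1 \<Longrightarrow> B z = c * z ^ m * (\<Prod>n. if n \<in> S then blaschke_factor (\<alpha> n) z else 1)"
    and c: "cmod c = 1"
    using rep by (simp_all add: blaschke_rep_def S_def)
  obtain \<eta> where \<eta>: "0 < \<eta>" "component_diameter B \<eta> < 1"
    using assms(2) unfolding weak_property_H_def by blast
  obtain M where M: "\<And>z F. cmod z < 1 \<Longrightarrow> finite F \<Longrightarrow> F \<subseteq> S \<Longrightarrow>
      (\<Sum>n\<in>F. 1 - (pseudohyperbolic (\<alpha> n) z)\<^sup>2) \<le> M"
    unfolding S_def using carleson_condition_of_component_diameter[OF rep \<eta>] by blast
  \<comment> \<open>A zero at distance less than 1/2 contributes more than 3/4, so certainly at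
    least 1/2, to a sum bounded by \<open>M\<close>. Hence there are at most 2 * M such
    neighbours.\<close>
  define K where "K = nat \<lceil>2 * M\<rceil>"
  define R where "R k n \<longleftrightarrow> pseudohyperbolic (\<alpha> k) (\<alpha> n) < 1/2" for k n
  have card: "card {k\<in>S. k < n \<and> R k n} \<le> K" if n: "n \<in> S" for n
  proof -
    let ?F = "{k\<in>S. k < n \<and> R k n}"
    have "(\<Sum>k\<in>?F. 1/2) \<le> (\<Sum>k\<in>?F. 1 - (pseudohyperbolic (\<alpha> k) (\<alpha> n))\<^sup>2)"
    proof (intro sum_mono)
      fix k assume "k \<in> ?F"
      then have "(pseudohyperbolic (\<alpha> k) (\<alpha> n))\<^sup>2 \<le> (1/2)\<^sup>2"
        using pseudohyperbolic_nonneg by (intro power_mono) (auto simp: R_def)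
      then show "1/2 \<le> 1 - (pseudohyperbolic (\<alpha> k) (\<alpha> n))\<^sup>2" by (simp add: power2_eq_square)
    qed
    also have "\<dots> \<le> M" using \<alpha>[OF n] by (intro M) auto
    finally have "real (card ?F) \<le> 2 * M" by simp
    then show ?thesis unfolding K_def by linarith
  qed
  obtain col where col: "\<And>n. n \<in> S \<Longrightarrow> col n \<le> K"
      "\<And>k n. k \<in> S \<Longrightarrow> n \<in> S \<Longrightarrow> k < n \<Longrightarrow> R k n \<Longrightarrow> col k \<noteq> col n"
    using finite_colouring[where S = S and K = K and R = R] card by blast
  \<comment> \<open>The subproduct over the colour class i; an empty class gives the constant
    1.\<close>
  define P where "P i z = (\<Prod>n. if n \<in> {n\<in>S. col n = i} then blaschke_factor (\<alpha> n) z else 1)" for i z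
  have sum_i: "summable (\<lambda>n. if n \<in> {n\<in>S. col n = i} then 1 - cmod (\<alpha> n) else 0)" for i
    by (rule summable_comparison_test'[OF sum, of 0]) (use \<alpha> in \<open>auto simp: less_imp_le\<close>)
  have "interpolating_blaschke (P i)" for i
    unfolding P_def[abs_def]
  proof (rule interpolating_blaschke_subset[OF _ sum_i, where M = M])
    fix j k assume jk: "j \<in> {n\<in>S. col n = i}" "k \<in> {n\<in>S. col n = i}" "j \<noteq> k"
    \<comment> \<open>The colouring speaks of pairs with the smaller index first; symmetry of \<rho>
      covers both orders.\<close>
    then have "\<not> R k j"
      using col(2)[of j k] col(2)[of k j] pseudohyperbolic_commute[of "\<alpha> j" "\<alpha> k"]
      by (auto simp: R_def neq_iff)
    then show "1/2 \<le> pseudohyperbolic (\<alpha> k) (\<alpha> j)" by (simp add: R_def)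
  next
    fix F j assume F: "finite F" "F \<subseteq> {n\<in>S. col n = i}" and j: "j \<in> {n\<in>S. col n = i}"
    then show "(\<Sum>k\<in>F. 1 - (pseudohyperbolic (\<alpha> k) (\<alpha> j))\<^sup>2) \<le> M"
      using \<alpha>[of j] by (intro M) auto
  qed (use \<alpha> in auto)
  \<comment> \<open>The colours 0, ..., K give \<open>Suc K\<close> classes. The constant c and the
    m zeros at the origin enter as further interpolating factors.\<close>
  then have "finite_interpolating_product (\<lambda>z. (\<Prod>i<Suc K. P i z) * c * z ^ m)"
    using c by (intro finite_interpolating_product_mult_power finite_interpolating_product_mult
        finite_interpolating_product_prod interpolating_blaschke_const)
  moreover have "B z = (\<Prod>i<Suc K. P i z) * c * z ^ m" if "z \<in> ball 0 1" for z
  proof -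
    have z: "cmod z < 1" using that by simp
    \<comment> \<open>Each subproduct converges, so the finite product over the colours can be moved
      inside the infinite one.\<close>
    have "(\<Prod>i<Suc K. P i z) = (\<Prod>n. \<Prod>i<Suc K. if n \<in> {n\<in>S. col n = i} then blaschke_factor (\<alpha> n) z else 1)"
      unfolding P_def using \<alpha> sum_i z by (intro prodinf_prod[symmetric] convergent_prod_blaschke) auto
    also have "\<dots> = (\<Prod>n. if n \<in> S then blaschke_factor (\<alpha> n) z else 1)"
    proof (intro prodinf_cong)
      fix n
      show "(\<Prod>i<Suc K. if n \<in> {n\<in>S. col n = i} then blaschke_factor (\<alpha> n) z else 1)
          = (if n \<in> S then blaschke_factor (\<alpha> n) z else 1)"
        \<comment> \<open>For n in \<open>S\<close> exactly the index i = col n contributes a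
          Blaschke factor, and col n \<le> K puts it in range.\<close>
        using col(1)[of n] by (auto simp del: prod.lessThan_Suc)
    qed
    finally show ?thesis using B[OF z] by (simp add: mult_ac)
  qed
  ultimately have "finite_interpolating_product B"
    using finite_interpolating_product_cong by (metis (no_types, lifting))
  then show ?thesis
    using assms(1) unfolding carleson_newman_def finite_interpolating_product_def by blast
qed

end
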